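(* Let $G$ be a finitely generated group, and let $K$ and $H$ be subgroups of $G$ with $[G:H]<\infty$. Then $(G,K)$ is context-free if and only if $(H,K\cap H)$ is context-free.
   Context: A *semigroup presentation* of a finitely generated group $G$ is a (not necessarily injective) map $\psi:\Sigma\to G$ from a finite alphabet $\Sigma$ such that its extension to a monoid homomorphism $\psi:\Sigma^*\to G$ is surjective. For a subgroup $K\le G$ (not necessarily finitely generated), $L(G,K,\psi)=\{w\in\Sigma^*:\psi(w)\in K\}$. The pair $(G,K)$ is *context-free* if $L(G,K,\psi)$ is a context-free language for some (equivalently, every) semigroup presentation $\psi$ of $G$. *)

theory Defs
  imports "HOL-Algebra.Algebra"
begin

datatype ('n, 't) symbol = NT 'n | Tm 't

record ('n, 't) grammar =
  nonterminals :: "'n set"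
  productions :: "('n \<times> ('n, 't) symbol list) set"
  start :: 'n

definition context_free_grammar :: "'t set \<Rightarrow> ('n, 't) grammar \<Rightarrow> bool" where
  "context_free_grammar \<Sigma> \<Gamma> \<longleftrightarrow>
     finite (nonterminals \<Gamma>) \<and> start \<Gamma> \<in> nonterminals \<Gamma> \<and>
     finite (productions \<Gamma>) \<and>
     productions \<Gamma> \<subseteq> nonterminals \<Gamma> \<times> lists (NT ` nonterminals \<Gamma> \<union> Tm ` \<Sigma>)"

inductive derives1 ::
  "('n, 't) grammar \<Rightarrow> ('n, 't) symbol list \<Rightarrow> ('n, 't) symbol list \<Rightarrow> bool"
  for \<Gamma> where
  "(A, \<alpha>) \<in> productions \<Gamma> \<Longrightarrow> derives1 \<Gamma> (u @ [NT A] @ v) (u @ \<alpha> @ v)"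

definition grammar_language :: "('n, 't) grammar \<Rightarrow> 't list set" where
  "grammar_language \<Gamma> = {w. (derives1 \<Gamma>)\<^sup>*\<^sup>* [NT (start \<Gamma>)] (map Tm w)}"

(* Nonterminals are taken from nat: a grammar has only finitely many of them,
   so up to renaming this is no restriction. *)
definition context_free_language :: "'t set \<Rightarrow> 't list set \<Rightarrow> bool" where
  "context_free_language \<Sigma> L \<longleftrightarrow>
     (\<exists>\<Gamma> :: (nat, 't) grammar. context_free_grammar \<Sigma> \<Gamma> \<and> L = grammar_language \<Gamma>)"

definition finitely_generated_group :: "('g, 'm) monoid_scheme \<Rightarrow> bool" where
  "finitely_generated_group G \<longleftrightarrow>
     group G \<and> (\<exists>S. finite S \<and> S \<subseteq> carrier G \<and> generate G S = carrier G)"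

definition word_value :: "('g, 'm) monoid_scheme \<Rightarrow> ('t \<Rightarrow> 'g) \<Rightarrow> 't list \<Rightarrow> 'g" where
  "word_value G \<psi> w = foldr (\<otimes>\<^bsub>G\<^esub>) (map \<psi> w) \<one>\<^bsub>G\<^esub>"

definition semigroup_presentation ::
  "('g, 'm) monoid_scheme \<Rightarrow> 't set \<Rightarrow> ('t \<Rightarrow> 'g) \<Rightarrow> bool" where
  "semigroup_presentation G \<Sigma> \<psi> \<longleftrightarrow>
     finite \<Sigma> \<and> \<psi> \<in> \<Sigma> \<rightarrow> carrier G \<and> word_value G \<psi> ` lists \<Sigma> = carrier G"

definition subgroup_language ::
  "('g, 'm) monoid_scheme \<Rightarrow> 'g set \<Rightarrow> 't set \<Rightarrow> ('t \<Rightarrow> 'g) \<Rightarrow> 't list set" where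
  "subgroup_language G K \<Sigma> \<psi> = {w \<in> lists \<Sigma>. word_value G \<psi> w \<in> K}"

(* Alphabets are finite, so taking their letters from nat is again only a renaming. *)
definition context_free_pair :: "('g, 'm) monoid_scheme \<Rightarrow> 'g set \<Rightarrow> bool" where
  "context_free_pair G K \<longleftrightarrow>
     (\<exists>(\<Sigma> :: nat set) \<psi>. semigroup_presentation G \<Sigma> \<psi> \<and>
        context_free_language \<Sigma> (subgroup_language G K \<Sigma> \<psi>))"

end

theory Submission
  imports Defs
begin

text \<open>
  Both directions express one language as the preimage of the other under a sequential function,
  that is, a deterministic automaton that outputs a word at every step and a final word at the end.
  Context-free languages are closed under such preimages, by the triple construction of Bar-Hillel,
  Perles and Shamir for finite transducers.
  If $(G,K)$ is context-free, rewrite the generators of $H$ (Schreier) as words over the generators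
  of $G$; this is a one-state automaton.
  Conversely the automaton has a finite transversal of $H$ as states. Reading $a$ in state $s$ it
  moves to the representative $t$ of $Hsa$ and outputs a word for $sat^{-1} \in H$, so an input of
  value $g$ that leads from $1$ to $t$ has output $gt^{-1}$.
  If $Ht$ contains some $k \in K$, the final output $tk^{-1}$ changes this to $gk^{-1}$, which lies
  in $K \cap H$ iff $g \in K$; otherwise $g \in Ht$ is not in $K$.
\<close>

section \<open>Grammars\<close>

text \<open>A big-step form of derivation in which every symbol of a sentential form contributes its
  own factor of the word. Rule induction then follows the derivation tree, which a sequence of
  \<open>derives1\<close> steps hides.\<close>

inductive produces :: "('n, 't) grammar \<Rightarrow> ('n, 't) symbol list \<Rightarrow> 't list \<Rightarrow> bool"
  for \<Gamma> where
  Nil: "produces \<Gamma> [] []"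
| Tm: "produces \<Gamma> \<alpha> w \<Longrightarrow> produces \<Gamma> (Tm t # \<alpha>) (t # w)"
| NT: "(A, \<beta>) \<in> productions \<Gamma> \<Longrightarrow> produces \<Gamma> \<beta> u \<Longrightarrow> produces \<Gamma> \<alpha> v
    \<Longrightarrow> produces \<Gamma> (NT A # \<alpha>) (u @ v)"

inductive_cases produces_NilE: "produces \<Gamma> [] w"
inductive_cases produces_TmE: "produces \<Gamma> (Tm t # \<alpha>) w"
inductive_cases produces_NTE: "produces \<Gamma> (NT A # \<alpha>) w"

lemma produces_append:
  "produces \<Gamma> \<alpha> u \<Longrightarrow> produces \<Gamma> \<beta> v \<Longrightarrow> produces \<Gamma> (\<alpha> @ \<beta>) (u @ v)"
  by (induction rule: produces.induct) (auto intro: produces.intros)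

text \<open>Each symbol owns a factor of the word, so a cut of the sentential form induces a cut of
  the word. This isolates the factor that belongs to a rewritten nonterminal.\<close>

lemma produces_appendD:
  "produces \<Gamma> (\<alpha> @ \<beta>) w \<Longrightarrow> \<exists>u v. w = u @ v \<and> produces \<Gamma> \<alpha> u \<and> produces \<Gamma> \<beta> v"
proof (induction \<alpha> arbitrary: w)
  case Nil
  then show ?case by (auto intro: produces.Nil)
next
  case (Cons Z \<alpha>)
  show ?case
  proof (cases Z)
    case (NT A)
    with Cons.prems obtain \<gamma> u w' where
      1: "w = u @ w'" "(A, \<gamma>) \<in> productions \<Gamma>" "produces \<Gamma> \<gamma> u" "produces \<Gamma> (\<alpha> @ \<beta>) w'"
      by (auto elim: produces_NTE)
    with Cons.IH obtain u' v where "w' = u' @ v" "produces \<Gamma> \<alpha> u'" "produces \<Gamma> \<beta> v"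
      by blast
    with 1 NT show ?thesis by (metis append.assoc produces.NT)
  next
    case (Tm t)
    with Cons.prems obtain w' where 1: "w = t # w'" "produces \<Gamma> (\<alpha> @ \<beta>) w'"
      by (auto elim: produces_TmE)
    with Cons.IH obtain u' v where "w' = u' @ v" "produces \<Gamma> \<alpha> u'" "produces \<Gamma> \<beta> v"
      by blast
    with 1 Tm show ?thesis by (metis append_Cons produces.Tm)
  qed
qed

lemma produces_map_Tm: "produces \<Gamma> (map Tm w) w"
  by (induction w) (auto intro: produces.intros)

lemma produces_single_NT:
  "produces \<Gamma> [NT A] w \<longleftrightarrow> (\<exists>\<beta>. (A, \<beta>) \<in> productions \<Gamma> \<and> produces \<Gamma> \<beta> w)"
  by (auto elim!: produces_NTE produces_NilE intro: produces.NT[where v = "[]", simplified] produces.Nil)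

lemma derives1_context: "derives1 \<Gamma> \<alpha> \<beta> \<Longrightarrow> derives1 \<Gamma> (l @ \<alpha> @ r) (l @ \<beta> @ r)"
  by (metis (no_types, opaque_lifting) append.assoc derives1.cases derives1.intros)

lemma derives_context:
  "(derives1 \<Gamma>)\<^sup>*\<^sup>* \<alpha> \<beta> \<Longrightarrow> (derives1 \<Gamma>)\<^sup>*\<^sup>* (l @ \<alpha> @ r) (l @ \<beta> @ r)"
  by (induction rule: rtranclp_induct) (auto intro: rtranclp.rtrancl_into_rtrancl derives1_context)

lemma produces_imp_derives: "produces \<Gamma> \<alpha> w \<Longrightarrow> (derives1 \<Gamma>)\<^sup>*\<^sup>* \<alpha> (map Tm w)"
proof (induction rule: produces.induct)
  case (Tm \<alpha> w t)
  then show ?case using derives_context[of \<Gamma> \<alpha> "map Tm w" "[Tm t]" "[]"] by simp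
next
  case (NT A \<beta> u \<alpha> v)
  have "derives1 \<Gamma> (NT A # \<alpha>) (\<beta> @ \<alpha>)"
    using derives1.intros[OF NT.hyps(1), of "[]" \<alpha>] by simp
  also have "(derives1 \<Gamma>)\<^sup>*\<^sup>* (\<beta> @ \<alpha>) (map Tm u @ \<alpha>)"
    using derives_context[OF NT.IH(1), of "[]" \<alpha>] by simp
  also have "(derives1 \<Gamma>)\<^sup>*\<^sup>* (map Tm u @ \<alpha>) (map Tm u @ map Tm v)"
    using derives_context[OF NT.IH(2), of "map Tm u" "[]"] by simp
  finally show ?case by simp
qed simp

text \<open>Backward closure: the factor produced by the inserted right-hand side is also produced
  by the nonterminal it replaced, and the factors on both sides are kept. Iterating this from the
  terminal word turns a derivation into a tree.\<close>

lemma derives1_produces: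
  assumes "derives1 \<Gamma> \<alpha> \<beta>" "produces \<Gamma> \<beta> w"
  shows "produces \<Gamma> \<alpha> w"
  using assms
proof cases
  case (1 A \<gamma> l r)
  then obtain u v x where "w = u @ v @ x" "produces \<Gamma> l u" "produces \<Gamma> \<gamma> v" "produces \<Gamma> r x"
    using assms(2) by (metis produces_appendD)
  with 1 show ?thesis by (auto intro!: produces_append produces.NT)
qed

lemma derives_iff_produces: "(derives1 \<Gamma>)\<^sup>*\<^sup>* \<alpha> (map Tm w) \<longleftrightarrow> produces \<Gamma> \<alpha> w"
proof
  show "produces \<Gamma> \<alpha> w" if "(derives1 \<Gamma>)\<^sup>*\<^sup>* \<alpha> (map Tm w)"
    using that by (induction rule: converse_rtranclp_induct) (auto intro: produces_map_Tm derives1_produces)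
qed (rule produces_imp_derives)

lemma grammar_language_produces: "grammar_language \<Gamma> = {w. produces \<Gamma> [NT (start \<Gamma>)] w}"
  by (simp add: grammar_language_def derives_iff_produces)

section \<open>Renaming nonterminals\<close>

text \<open>Relabelling the nodes of a derivation tree gives a derivation tree. Applied to an
  injective renaming and to its inverse, it yields the two inclusions between the languages.\<close>

lemma produces_map:
  assumes "produces \<Gamma> \<alpha> w"
    and "\<And>A \<beta>. (A, \<beta>) \<in> productions \<Gamma> \<Longrightarrow> (f A, map (map_symbol f (\<lambda>t. t)) \<beta>) \<in> productions \<Gamma>'"
  shows "produces \<Gamma>' (map (map_symbol f (\<lambda>t. t)) \<alpha>) w"
  using assms(1)
proof induction
  case (NT A \<beta> u \<alpha> v)
  then show ?case using produces.NT[OF assms(2)] by simp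
qed (auto intro: produces.intros)

text \<open>\<open>context_free_language\<close> fixes the nonterminals to be natural numbers, while
  the construction below uses triples. A finite set of nonterminals embeds into the naturals, and
  renaming along the embedding preserves the language.\<close>

lemma context_free_language_grammar:
  fixes \<Gamma> :: "('n, 't) grammar"
  assumes "context_free_grammar \<Sigma> \<Gamma>"
  shows "context_free_language \<Sigma> (grammar_language \<Gamma>)"
proof -
  let ?N = "nonterminals \<Gamma>"
  have fin: "finite ?N" "finite (productions \<Gamma>)" and start: "start \<Gamma> \<in> ?N"
    and sub: "productions \<Gamma> \<subseteq> ?N \<times> lists (NT ` ?N \<union> Tm ` \<Sigma>)"
    using assms by (auto simp: context_free_grammar_def)
  obtain f :: "'n \<Rightarrow> nat" where f: "inj_on f ?N"
    using finite_imp_inj_to_nat_seg[OF fin(1)] by blast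
  let ?g = "inv_into ?N f"
  define \<Gamma>' where "\<Gamma>' = \<lparr>nonterminals = f ` ?N,
    productions = map_prod f (map (map_symbol f (\<lambda>t. t))) ` productions \<Gamma>, start = f (start \<Gamma>)\<rparr>"
  \<comment> \<open>\<open>f\<close> is injective only on the nonterminals of the grammar, so
    \<open>?g\<close> undoes it only on sentential forms over these.\<close>
  have inverse: "map (map_symbol ?g (\<lambda>t. t)) (map (map_symbol f (\<lambda>t. t)) \<alpha>) = \<alpha>"
    if "\<alpha> \<in> lists (NT ` ?N \<union> Tm ` \<Sigma>)" for \<alpha>
    using that f by (induction \<alpha>) auto
  have "context_free_grammar \<Sigma> \<Gamma>'"
    using fin start sub unfolding context_free_grammar_def \<Gamma>'_def by (fastforce simp: in_lists_conv_set)
  moreover have "grammar_language \<Gamma> = grammar_language \<Gamma>'"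
  proof -
    have "produces \<Gamma>' [NT (f (start \<Gamma>))] w" if "produces \<Gamma> [NT (start \<Gamma>)] w" for w
      using produces_map[OF that, of f \<Gamma>'] by (force simp: \<Gamma>'_def)
    moreover have "produces \<Gamma> [NT (start \<Gamma>)] w" if "produces \<Gamma>' [NT (f (start \<Gamma>))] w" for w
    proof -
      have "(?g A, map (map_symbol ?g (\<lambda>t. t)) \<beta>) \<in> productions \<Gamma>" if "(A, \<beta>) \<in> productions \<Gamma>'" for A \<beta>
      proof -
        from that obtain B \<gamma> where B: "(B, \<gamma>) \<in> productions \<Gamma>" "A = f B" "\<beta> = map (map_symbol f (\<lambda>t. t)) \<gamma>"
          by (auto simp: \<Gamma>'_def)
        with sub have "B \<in> ?N" "\<gamma> \<in> lists (NT ` ?N \<union> Tm ` \<Sigma>)" by auto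
        with B inverse f show ?thesis by simp
      qed
      from produces_map[OF that this] show ?thesis using start f by simp
    qed
    ultimately show ?thesis by (auto simp: grammar_language_produces) (auto simp: \<Gamma>'_def)
  qed
  ultimately show ?thesis by (auto simp: context_free_language_def)
qed

section \<open>Invariants for the languages of nonterminals\<close>

text \<open>The sentential form is read as a product of languages, with \<open>M A\<close>
  substituted for the nonterminal \<open>A\<close>.\<close>

fun interp :: "('n \<Rightarrow> 't list set) \<Rightarrow> ('n, 't) symbol list \<Rightarrow> 't list set" where
  "interp M [] = {[]}"
| "interp M (Tm t # \<alpha>) = (#) t ` interp M \<alpha>"
| "interp M (NT A # \<alpha>) = {u @ v | u v. u \<in> M A \<and> v \<in> interp M \<alpha>}"

lemma interp_map_Tm: "interp M (map Tm y @ \<alpha>) = (@) y ` interp M \<alpha>"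
  by (induction y) auto

text \<open>The true languages of the nonterminals are the least solution of the inclusions given by
  the productions, so every \<open>M\<close> that satisfies these inclusions bounds them from
  above.\<close>

lemma produces_interp:
  assumes "produces \<Gamma> \<alpha> w" and "\<And>A \<beta>. (A, \<beta>) \<in> productions \<Gamma> \<Longrightarrow> interp M \<beta> \<subseteq> M A"
  shows "w \<in> interp M \<alpha>"
  using assms(1)
proof induction
  case (NT A \<beta> u \<alpha> v)
  then show ?case using assms(2)[of A \<beta>] by auto
qed auto

section \<open>Finite transducers\<close>

text \<open>An edge reads at most one letter (\<open>None\<close> for no letter) but may write a
  whole word. Thus inputs can be cut anywhere, while outputs are cut only between edges.\<close>

inductive path ::
  "('q \<times> 'd option \<times> 't list \<times> 'q) set \<Rightarrow> 'q \<Rightarrow> 'd list \<Rightarrow> 't list \<Rightarrow> 'q \<Rightarrow> bool"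
  for E where
  refl: "path E p [] [] p"
| eps: "(p, None, y, p') \<in> E \<Longrightarrow> path E p' x z q \<Longrightarrow> path E p x (y @ z) q"
| read: "(p, Some d, y, p') \<in> E \<Longrightarrow> path E p' x z q \<Longrightarrow> path E p (d # x) (y @ z) q"

lemma path_append:
  "path E p x y r \<Longrightarrow> path E r x' y' q \<Longrightarrow> path E p (x @ x') (y @ y') q"
  by (induction rule: path.induct) (auto intro: path.intros)

text \<open>No edge reads across the cut, since it reads at most one letter. Edges without input
  that lie at the cut may fall on either side, so \<open>r\<close> is not unique in general.\<close>

lemma path_split:
  assumes "path E p (x1 @ x2) y q"
  shows "\<exists>r y1 y2. y = y1 @ y2 \<and> path E p x1 y1 r \<and> path E r x2 y2 q"
  using assms
proof (induction p "x1 @ x2" y q arbitrary: x1 rule: path.induct)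
  case (refl p)
  then show ?case by (auto intro: path.refl)
next
  case (eps p y p' z q)
  then show ?case by (metis append.assoc path.eps)
next
  case (read p d y p' x z q)
  show ?case
  proof (cases x1)
    case Nil
    with read show ?thesis by (metis append_Nil path.read path.refl)
  next
    case (Cons d' x1')
    with read show ?thesis by (metis append.assoc append_Cons list.inject path.read)
  qed
qed

section \<open>The triple grammar\<close>

locale transducer =
  fixes E :: "('q \<times> 'd option \<times> 't list \<times> 'q) set" and Q :: "'q set"
    and \<Delta> :: "'d set" and \<Sigma> :: "'t set" and \<Gamma> :: "('n, 'd) grammar"
  assumes edges: "E \<subseteq> Q \<times> insert None (Some ` \<Delta>) \<times> lists \<Sigma> \<times> Q"
    and finite: "finite E" "finite Q" "finite \<Delta>"
    and grammar: "context_free_grammar \<Delta> \<Gamma>"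
begin

definition labels :: "('n, 'd) symbol option set" where
  "labels = insert None (Some ` (NT ` nonterminals \<Gamma> \<union> Tm ` \<Delta>))"

text \<open>The nonterminal \<open>(p, Z, q)\<close> produces the outputs of the paths from \<open>p\<close> to \<open>q\<close> that read a word
  produced by \<open>Z\<close>, where \<open>None\<close> stands for the empty sentential form.\<close>

primrec thread :: "'q \<Rightarrow> 'q \<Rightarrow> ('n, 'd) symbol list \<Rightarrow>
    ('q \<times> ('n, 'd) symbol option \<times> 'q, 't) symbol list set" where
  "thread p q [] = {[NT (p, None, q)]}"
| "thread p q (Z # \<alpha>) = (\<Union>r\<in>Q. (#) (NT (p, Some Z, r)) ` thread r q \<alpha>)"

text \<open>A production of \<open>\<Gamma>\<close> is simulated by guessing the states between the
  symbols of its right-hand side. The last triple of a thread, labelled \<open>None\<close>, absorbs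
  the edges without input that follow the last symbol.\<close>

definition rule_prods where
  "rule_prods = (\<Union>(A, \<alpha>)\<in>productions \<Gamma>. \<Union>p\<in>Q. \<Union>q\<in>Q. {(p, Some (NT A), q)} \<times> thread p q \<alpha>)"

text \<open>An edge without input may be taken first, whatever label is still to be read.\<close>

definition eps_prods where
  "eps_prods = (\<lambda>((p, a, y, r), Z, q). ((p, Z, q), map Tm y @ [NT (r, Z, q)]))
     ` ({e \<in> E. fst (snd e) = None} \<times> labels \<times> Q)"

text \<open>An edge reading \<open>d\<close> uses up the label \<open>Some (Tm d)\<close>, and an
  edge without input fits the label \<open>None\<close>. In both cases nothing is left to be
  read.\<close>

definition read_prods where
  "read_prods = (\<lambda>((p, a, y, r), q). ((p, map_option Tm a, q), map Tm y @ [NT (r, None, q)])) ` (E \<times> Q)"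

definition nil_prods :: "(('q \<times> ('n, 'd) symbol option \<times> 'q) \<times> ('q \<times> ('n, 'd) symbol option \<times> 'q, 't) symbol list) set"
  where "nil_prods = (\<lambda>p. ((p, None, p), [])) ` Q"

definition triples :: "'q \<Rightarrow> 'q \<Rightarrow> ('q \<times> ('n, 'd) symbol option \<times> 'q, 't) grammar" where
  "triples p q = \<lparr>nonterminals = Q \<times> labels \<times> Q,
     productions = rule_prods \<union> eps_prods \<union> read_prods \<union> nil_prods,
     start = (p, Some (NT (start \<Gamma>)), q)\<rparr>"

lemma finite_thread: "finite (thread p q \<alpha>)"
  by (induction \<alpha> arbitrary: p) (auto simp: finite)

lemma thread_lists:
  assumes "\<alpha> \<in> lists (NT ` nonterminals \<Gamma> \<union> Tm ` \<Delta>)" "p \<in> Q" "q \<in> Q"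
  shows "thread p q \<alpha> \<subseteq> lists (NT ` (Q \<times> labels \<times> Q))"
  using assms
proof (induction \<alpha> arbitrary: p rule: list.induct)
  case (Cons Z \<alpha>)
  then have "Some Z \<in> labels" and \<alpha>: "\<alpha> \<in> lists (NT ` nonterminals \<Gamma> \<union> Tm ` \<Delta>)"
    by (auto simp: labels_def)
  with Cons.IH[OF \<alpha> _ Cons.prems(3)] Cons.prems(2) show ?case by auto blast
qed (auto simp: labels_def)

lemma context_free_triples:
  assumes "p \<in> Q" "q \<in> Q"
  shows "context_free_grammar \<Sigma> (triples p q)"
proof -
  let ?N = "Q \<times> labels \<times> Q"
  let ?R = "?N \<times> lists (NT ` ?N \<union> Tm ` \<Sigma>)"
  have g: "finite (nonterminals \<Gamma>)" "start \<Gamma> \<in> nonterminals \<Gamma>" "finite (productions \<Gamma>)"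
    "productions \<Gamma> \<subseteq> nonterminals \<Gamma> \<times> lists (NT ` nonterminals \<Gamma> \<union> Tm ` \<Delta>)"
    using grammar by (auto simp: context_free_grammar_def)
  have "finite labels" using g finite by (simp add: labels_def)
  then have "finite (productions (triples p q))"
    using g finite
    by (auto simp: triples_def rule_prods_def eps_prods_def read_prods_def nil_prods_def finite_thread)
  moreover have "rule_prods \<subseteq> ?R"
  proof -
    have "((p, Some (NT A), q), \<beta>) \<in> ?R"
      if "(A, \<alpha>) \<in> productions \<Gamma>" "p \<in> Q" "q \<in> Q" "\<beta> \<in> thread p q \<alpha>" for A \<alpha> p q \<beta>
    proof -
      from that g have "A \<in> nonterminals \<Gamma>" "\<alpha> \<in> lists (NT ` nonterminals \<Gamma> \<union> Tm ` \<Delta>)" by auto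
      moreover from this that have "\<beta> \<in> lists (NT ` ?N)" using thread_lists by blast
      ultimately show ?thesis using that lists_mono[of "NT ` ?N" "NT ` ?N \<union> Tm ` \<Sigma>"]
        by (auto simp: labels_def)
    qed
    then show ?thesis unfolding rule_prods_def by fast
  qed
  moreover have "eps_prods \<subseteq> ?R" "read_prods \<subseteq> ?R" "nil_prods \<subseteq> ?R"
    using edges unfolding eps_prods_def read_prods_def nil_prods_def labels_def
    by (fastforce simp: in_lists_conv_set)+
  ultimately show ?thesis
    using g finite \<open>finite labels\<close> assms
    by (auto simp: context_free_grammar_def triples_def) (auto simp: labels_def)
qed

section \<open>Soundness of the triple grammar\<close>

text \<open>The intended language of a triple, serving as the invariant \<open>M\<close> of
  \<open>produces_interp\<close>.\<close>

definition meaning :: "'q \<times> ('n, 'd) symbol option \<times> 'q \<Rightarrow> 't list set" where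
  "meaning = (\<lambda>(p, Z, q). {y. \<exists>x. produces \<Gamma> (case Z of None \<Rightarrow> [] | Some Y \<Rightarrow> [Y]) x \<and> path E p x y q})"

text \<open>Consecutive triples of a thread share a state, so the paths that they describe can be
  concatenated.\<close>

lemma thread_sound:
  assumes "\<beta> \<in> thread p q \<alpha>" "y \<in> interp meaning \<beta>"
  shows "\<exists>x. produces \<Gamma> \<alpha> x \<and> path E p x y q"
  using assms
proof (induction \<alpha> arbitrary: p \<beta> y)
  case Nil
  then show ?case by (auto simp: meaning_def)
next
  case (Cons Z \<alpha>)
  then obtain r \<beta>' u v where "\<beta>' \<in> thread r q \<alpha>" "y = u @ v" "u \<in> meaning (p, Some Z, r)"
    "v \<in> interp meaning \<beta>'" by auto
  with Cons.IH obtain x x' where "produces \<Gamma> [Z] x" "path E p x u r" "produces \<Gamma> \<alpha> x'" "path E r x' v q"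
    by (fastforce simp: meaning_def)
  with \<open>y = u @ v\<close> show ?case
    using path_append[of E p x u r x' v q] produces_append[of \<Gamma> "[Z]" x \<alpha> x'] by auto
qed

text \<open>Each of the four kinds of production respects the intended languages. This is the
  hypothesis of \<open>produces_interp\<close>, so soundness takes no further induction on
  derivations.\<close>

lemma triples_sound:
  assumes "(A, \<beta>) \<in> productions (triples p q)"
  shows "interp meaning \<beta> \<subseteq> meaning A"
proof
  fix y assume y: "y \<in> interp meaning \<beta>"
  from assms consider "(A, \<beta>) \<in> rule_prods" | "(A, \<beta>) \<in> eps_prods" | "(A, \<beta>) \<in> read_prods" | "(A, \<beta>) \<in> nil_prods"
    by (auto simp: triples_def)
  then show "y \<in> meaning A"
  proof cases
    case 1
    then obtain B \<alpha> r s where B: "(B, \<alpha>) \<in> productions \<Gamma>" "A = (r, Some (NT B), s)" "\<beta> \<in> thread r s \<alpha>"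
      by (auto simp: rule_prods_def)
    with thread_sound[OF B(3) y] show ?thesis by (auto simp: meaning_def produces_single_NT)
  next
    case 2
    then obtain r s t Z z where "(r, None, z, t) \<in> E" "A = (r, Z, s)" "\<beta> = map Tm z @ [NT (t, Z, s)]"
      by (auto simp: eps_prods_def)
    with y show ?thesis by (auto simp: interp_map_Tm meaning_def intro: path.eps)
  next
    case 3
    then obtain r s t a z where "(r, a, z, t) \<in> E" "A = (r, map_option Tm a, s)"
        "\<beta> = map Tm z @ [NT (t, None, s)]"
      by (auto simp: read_prods_def)
    with y show ?thesis
      by (cases a) (auto simp: interp_map_Tm meaning_def elim!: produces_NilE
          intro: path.eps path.read produces.intros)
  next
    case 4
    with y show ?thesis by (auto simp: nil_prods_def meaning_def intro!: exI[of _ "[]"] path.refl produces.Nil)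
  qed
qed

section \<open>Completeness of the triple grammar\<close>

text \<open>Every edge has both ends in \<open>Q\<close>. An equivalence is the right form because
  an empty path may sit at any point, even outside \<open>Q\<close>.\<close>

lemma path_states: "path E p x y q \<Longrightarrow> p \<in> Q \<longleftrightarrow> q \<in> Q"
  by (induction rule: path.induct) (use edges in auto)

lemma triples_path_Nil:
  assumes "path E p [] y q" "q \<in> Q"
  shows "produces (triples p0 q0) [NT (p, None, q)] y"
  using assms
proof (induction p "[] :: 'd list" y q rule: path.induct)
  case (refl p)
  then have "((p, None, p), []) \<in> productions (triples p0 q0)"
    by (auto simp: triples_def nil_prods_def)
  then show ?case using produces.Nil unfolding produces_single_NT by blast
next
  case (eps p y p' z q)
  then have "((p, None, q), map Tm y @ [NT (p', None, q)]) \<in> productions (triples p0 q0)"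
    by (force simp: triples_def read_prods_def)
  with eps show ?case
    unfolding produces_single_NT[of _ "(p, None, q)"] by (blast intro: produces_append produces_map_Tm)
qed

text \<open>The path has three stages: edges without input are handled by \<open>eps_prods\<close>,
  the edge reading \<open>d\<close> by \<open>read_prods\<close>, and the rest by
  \<open>triples_path_Nil\<close>.\<close>

lemma triples_path_letter:
  assumes "path E p [d] y q" "q \<in> Q"
  shows "produces (triples p0 q0) [NT (p, Some (Tm d), q)] y"
  using assms
proof (induction p "[d]" y q rule: path.induct)
  case (eps p y p' z q)
  \<comment> \<open>The label \<open>Some (Tm d)\<close> is admissible only if \<open>d\<close> lies
    in \<open>\<Delta>\<close>; the edge that reads \<open>d\<close> further along the path shows
    this.\<close>
  from eps.hyps(2) have "d \<in> \<Delta>"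
    by (induction p' "[d]" z q rule: path.induct) (use edges in auto)
  with eps have "((p, Some (Tm d), q), map Tm y @ [NT (p', Some (Tm d), q)]) \<in> productions (triples p0 q0)"
    by (force simp: triples_def eps_prods_def labels_def)
  with eps show ?case
    unfolding produces_single_NT[of _ "(p, Some (Tm d), q)"]
    by (blast intro: produces_append produces_map_Tm)
next
  case (read p y p' z q)
  then have "((p, Some (Tm d), q), map Tm y @ [NT (p', None, q)]) \<in> productions (triples p0 q0)"
    by (force simp: triples_def read_prods_def)
  with read triples_path_Nil show ?case
    unfolding produces_single_NT[of _ "(p, Some (Tm d), q)"]
    by (blast intro: produces_append produces_map_Tm)
qed

text \<open>Along the derivation of \<open>x\<close>, the path is cut where the factors of
  \<open>x\<close> meet, and the states at the cuts are the guesses made by the thread. The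
  parameters \<open>p0\<close> and \<open>q0\<close> affect only the start symbol of the
  grammar.\<close>

lemma thread_complete:
  assumes "produces \<Gamma> \<alpha> x" "path E p x y q" "p \<in> Q" "q \<in> Q"
  shows "\<exists>\<beta>\<in>thread p q \<alpha>. produces (triples p0 q0) \<beta> y"
  using assms
proof (induction arbitrary: p q y rule: produces.induct)
  case Nil
  then show ?case by (simp add: triples_path_Nil)
next
  case (Tm \<alpha> w d)
  then obtain r y1 y2 where r: "y = y1 @ y2" "path E p [d] y1 r" "path E r w y2 q"
    using path_split[of E p "[d]" w y q] by auto
  with Tm.prems have "r \<in> Q" using path_states by blast
  with r Tm.IH Tm.prems obtain \<beta> where "\<beta> \<in> thread r q \<alpha>" "produces (triples p0 q0) \<beta> y2"
    by blast
  moreover have "produces (triples p0 q0) [NT (p, Some (Tm d), r)] y1"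
    using r \<open>r \<in> Q\<close> triples_path_letter by blast
  ultimately show ?case using \<open>r \<in> Q\<close> r(1) produces_append by fastforce
next
  case (NT A \<gamma> u \<alpha> v)
  then obtain r y1 y2 where r: "y = y1 @ y2" "path E p u y1 r" "path E r v y2 q"
    using path_split[of E p u v y q] by auto
  with NT.prems have "r \<in> Q" using path_states by blast
  with r NT.IH(2) NT.prems obtain \<beta> where "\<beta> \<in> thread r q \<alpha>" "produces (triples p0 q0) \<beta> y2"
    by blast
  moreover have "produces (triples p0 q0) [NT (p, Some (NT A), r)] y1"
  proof -
    \<comment> \<open>The subtree below \<open>A\<close> is threaded along the part of the path that
      reads \<open>u\<close>.\<close>
    obtain \<delta> where "\<delta> \<in> thread p r \<gamma>" "produces (triples p0 q0) \<delta> y1"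
      using NT.IH(1) r \<open>r \<in> Q\<close> NT.prems by blast
    moreover have "((p, Some (NT A), r), \<delta>) \<in> productions (triples p0 q0)"
      using NT.hyps \<open>r \<in> Q\<close> NT.prems calculation by (force simp: triples_def rule_prods_def)
    ultimately show ?thesis unfolding produces_single_NT by blast
  qed
  ultimately show ?case using \<open>r \<in> Q\<close> r(1) produces_append by fastforce
qed

lemma triples_language:
  assumes "p \<in> Q" "q \<in> Q"
  shows "grammar_language (triples p q) = {y. \<exists>x\<in>grammar_language \<Gamma>. path E p x y q}"
proof (intro Set.set_eqI iffI)
  fix y assume "y \<in> grammar_language (triples p q)"
  then have "produces (triples p q) [NT (p, Some (NT (start \<Gamma>)), q)] y"
    by (simp add: grammar_language_produces) (simp add: triples_def)
  from produces_interp[OF this triples_sound]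
  show "y \<in> {y. \<exists>x\<in>grammar_language \<Gamma>. path E p x y q}"
    by (auto simp: meaning_def grammar_language_produces)
next
  fix y assume "y \<in> {y. \<exists>x\<in>grammar_language \<Gamma>. path E p x y q}"
  then obtain x \<alpha> where x: "(start \<Gamma>, \<alpha>) \<in> productions \<Gamma>" "produces \<Gamma> \<alpha> x" "path E p x y q"
    by (auto simp: grammar_language_produces produces_single_NT)
  with assms obtain \<beta> where \<beta>: "\<beta> \<in> thread p q \<alpha>" "produces (triples p q) \<beta> y"
    using thread_complete by blast
  have "((p, Some (NT (start \<Gamma>)), q), \<beta>) \<in> productions (triples p q)"
    using x \<beta> assms by (force simp: triples_def rule_prods_def)
  with \<beta> have "produces (triples p q) [NT (p, Some (NT (start \<Gamma>)), q)] y"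
    unfolding produces_single_NT by blast
  then show "y \<in> grammar_language (triples p q)"
    by (simp add: grammar_language_produces) (simp add: triples_def)
qed

end

text \<open>The triple grammar generates the image of \<open>L\<close>; its nonterminals are then
  renamed to natural numbers.\<close>

lemma context_free_transduction:
  assumes L: "context_free_language \<Delta> L"
    and "finite \<Delta>" "finite Q" "p \<in> Q" "q \<in> Q" "finite E"
    and "E \<subseteq> Q \<times> insert None (Some ` \<Delta>) \<times> lists \<Sigma> \<times> Q"
  shows "context_free_language \<Sigma> {y. \<exists>x\<in>L. path E p x y q}"
proof -
  obtain \<Gamma> :: "(nat, 'a) grammar" where \<Gamma>: "context_free_grammar \<Delta> \<Gamma>" "L = grammar_language \<Gamma>"
    using L by (auto simp: context_free_language_def)
  interpret transducer E Q \<Delta> \<Sigma> \<Gamma> by unfold_locales (use assms \<Gamma> in auto)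
  show ?thesis
    using context_free_language_grammar[OF context_free_triples[OF assms(4,5)]]
    by (simp add: triples_language[OF assms(4,5)] \<Gamma>(2))
qed

section \<open>Sequential functions\<close>

primrec seq_output :: "('q \<Rightarrow> 't \<Rightarrow> 'q) \<Rightarrow> ('q \<Rightarrow> 't \<Rightarrow> 'd list) \<Rightarrow> 'q \<Rightarrow> 't list \<Rightarrow> 'd list" where
  "seq_output \<delta> out q [] = []"
| "seq_output \<delta> out q (a # w) = out q a @ seq_output \<delta> out (\<delta> q a) w"

text \<open>The sequential function is run backwards by a transducer that reads a word of
  \<open>L\<close> and writes \<open>w\<close>. It guesses a letter of \<open>w\<close>, writes it,
  and then checks the corresponding output against its own input. As edges read single letters, the
  unchecked rest of the output is stored in the state.\<close>

lemma context_free_sequential_preimage: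
  fixes \<delta> :: "'q \<Rightarrow> 't \<Rightarrow> 'q" and out :: "'q \<Rightarrow> 't \<Rightarrow> 'd list"
  assumes L: "context_free_language \<Delta> L" and fin: "finite \<Delta>" "finite \<Sigma>" "finite Q" "finite F"
    and q0: "q0 \<in> Q" and \<delta>: "\<And>q a. q \<in> Q \<Longrightarrow> a \<in> \<Sigma> \<Longrightarrow> \<delta> q a \<in> Q"
    and out: "\<And>q a. q \<in> Q \<Longrightarrow> a \<in> \<Sigma> \<Longrightarrow> out q a \<in> lists \<Delta>"
    and F: "F \<subseteq> Q \<times> lists \<Delta>"
  shows "context_free_language \<Sigma>
    {w \<in> lists \<Sigma>. \<exists>z. (foldl \<delta> q0 w, z) \<in> F \<and> seq_output \<delta> out q0 w @ z \<in> L}"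
proof -
  \<comment> \<open>All suffixes of outputs and final words, a finite set closed under
    \<open>tl\<close>. The empty word is inserted so that \<open>W\<close> contains it even when
    there are no outputs.\<close>
  define W where "W = (\<Union>w\<in>insert [] (case_prod out ` (Q \<times> \<Sigma>) \<union> snd ` F). (\<lambda>n. drop n w) ` {..length w})"
  text \<open>A state \<open>(s, r)\<close> still has to read \<open>r\<close>; \<open>s = None\<close> means that the input has ended.\<close>
  define S where "S = insert None (Some ` Q) \<times> W"
  \<comment> \<open>The edges guess a letter and load its output, end the word and load a final
    output, or check one pending letter. The first two kinds start only when nothing is
    pending.\<close>
  define E where "E = (\<lambda>(q, a). ((Some q, []), None, [a], (Some (\<delta> q a), out q a))) ` (Q \<times> \<Sigma>)
    \<union> (\<lambda>(q, z). ((Some q, []), None, [], (None, z))) ` F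
    \<union> (\<lambda>(s, r). ((s, r), Some (hd r), [], (s, tl r))) ` {x \<in> S. snd x \<noteq> []}"
  have W_Nil: "[] \<in> W" by (auto simp: W_def)
  have W_base: "w \<in> W" if "w \<in> case_prod out ` (Q \<times> \<Sigma>) \<union> snd ` F" for w
    unfolding W_def using that by (force intro: image_eqI[of _ _ 0])
  have W_tl: "tl w \<in> W" if "w \<in> W" "w \<noteq> []" for w
  proof -
    from that obtain n u where u: "u \<in> insert [] (case_prod out ` (Q \<times> \<Sigma>) \<union> snd ` F)" "w = drop n u" "n < length u"
      unfolding W_def by (force simp: le_eq_less_or_eq)
    then have "tl w = drop (Suc n) u" by (simp add: drop_Suc tl_drop)
    with u show ?thesis unfolding W_def by (intro UN_I[of u] image_eqI[of _ _ "Suc n"]) auto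
  qed
  have W_lists: "W \<subseteq> lists \<Delta>"
    using out F by (fastforce simp: W_def in_lists_conv_set dest: in_set_dropD)
  have fin': "finite W" "finite S" "finite E" using fin by (auto simp: W_def S_def E_def)
  have E_sub: "E \<subseteq> S \<times> insert None (Some ` \<Delta>) \<times> lists \<Sigma> \<times> S"
  proof -
    have "hd r \<in> \<Delta>" if "r \<in> W" "r \<noteq> []" for r using W_lists that by (cases r) auto
    then have 1: "(\<lambda>(s, r). ((s, r), Some (hd r), [], (s, tl r))) ` {x \<in> S. snd x \<noteq> []}
        \<subseteq> S \<times> insert None (Some ` \<Delta>) \<times> lists \<Sigma> \<times> S"
      using W_tl unfolding S_def by auto
    have "out q a \<in> W" if "q \<in> Q" "a \<in> \<Sigma>" for q a using that by (intro W_base) auto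
    then have 2: "(\<lambda>(q, a). ((Some q, []), None, [a], (Some (\<delta> q a), out q a))) ` (Q \<times> \<Sigma>)
        \<subseteq> S \<times> insert None (Some ` \<Delta>) \<times> lists \<Sigma> \<times> S"
      using W_Nil \<delta> unfolding S_def by auto
    have "z \<in> W" "q \<in> Q" if "(q, z) \<in> F" for q z
      using that F by (force intro: W_base)+
    then have 3: "(\<lambda>(q, z). ((Some q, []), None, [], (None, z))) ` F
        \<subseteq> S \<times> insert None (Some ` \<Delta>) \<times> lists \<Sigma> \<times> S"
      using W_Nil unfolding S_def by auto
    show ?thesis unfolding E_def using 1 2 3 by (intro Un_least)
  qed
  \<comment> \<open>The claim describes what is still read and written on the way to the accepting
    state: first the pending word \<open>r\<close>, then, unless the word has ended, the output for
    \<open>y\<close> and a final output.\<close>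
  have sound: "case s of (None, r) \<Rightarrow> y = [] \<and> x = r
      | (Some q, r) \<Rightarrow> y \<in> lists \<Sigma> \<and> (\<exists>z. (foldl \<delta> q y, z) \<in> F \<and> x = r @ seq_output \<delta> out q y @ z)"
    if "path E s x y t" "t = (None, [])" for s x y t
    using that
  proof induction
    case (eps p y p' x z q)
    then show ?case by (auto simp: E_def)
  next
    case (read p d y p' x z q)
    then show ?case by (auto simp: E_def split: prod.splits option.splits)
  qed simp
  have read: "path E (s, r) r [] (s, [])" if "s \<in> insert None (Some ` Q)" "r \<in> W" for s r
    using that(2)
  proof (induction r)
    case (Cons d r)
    then have "(s, d # r) \<in> {x \<in> S. snd x \<noteq> []}" using that(1) by (simp add: S_def)
    from imageI[OF this, of "\<lambda>(s, r). ((s, r), Some (hd r), [], (s, tl r))"]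
    have "((s, d # r), Some d, [], (s, r)) \<in> E" unfolding E_def by (intro UnI2) simp
    moreover have "r \<in> W" using W_tl[OF Cons.prems] by simp
    ultimately show ?case using path.read[OF _ Cons.IH] by fastforce
  qed (rule path.refl)
  have complete: "path E (Some q, []) (seq_output \<delta> out q y @ z) y (None, [])"
    if "y \<in> lists \<Sigma>" "q \<in> Q" "(foldl \<delta> q y, z) \<in> F" for q y z
    using that
  proof (induction y arbitrary: q rule: list.induct)
    case Nil
    then have "((Some q, []), None, [], (None, z)) \<in> E" by (force simp: E_def)
    moreover have "z \<in> W" using Nil by (intro W_base) force
    ultimately show ?case using path.eps[OF _ read[of None z]] by simp
  next
    case (Cons a y)
    then have "((Some q, []), None, [a], (Some (\<delta> q a), out q a)) \<in> E" by (force simp: E_def)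
    moreover have "path E (Some (\<delta> q a), out q a) (out q a) [] (Some (\<delta> q a), [])"
      using Cons.prems \<delta> by (intro read W_base) auto
    moreover have "path E (Some (\<delta> q a), []) (seq_output \<delta> out (\<delta> q a) y @ z) y (None, [])"
      using Cons \<delta> by auto
    ultimately show ?case using path.eps[OF _ path_append] by fastforce
  qed
  have "(\<exists>x\<in>L. path E (Some q0, []) x y (None, [])) \<longleftrightarrow>
      y \<in> lists \<Sigma> \<and> (\<exists>z. (foldl \<delta> q0 y, z) \<in> F \<and> seq_output \<delta> out q0 y @ z \<in> L)" (is "?l \<longleftrightarrow> ?r") for y
  proof
    assume ?l
    then obtain x where x: "x \<in> L" "path E (Some q0, []) x y (None, [])" by blast
    show ?r using sound[OF x(2) HOL.refl] x(1) by (simp del: in_lists_conv_set) blast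
  next
    assume ?r
    then show ?l using complete[OF _ q0] by blast
  qed
  then have "{y. \<exists>x\<in>L. path E (Some q0, []) x y (None, [])}
      = {w \<in> lists \<Sigma>. \<exists>z. (foldl \<delta> q0 w, z) \<in> F \<and> seq_output \<delta> out q0 w @ z \<in> L}"
    by simp
  moreover have "context_free_language \<Sigma> {y. \<exists>x\<in>L. path E (Some q0, []) x y (None, [])}"
    by (rule context_free_transduction[OF L fin(1) fin'(2) _ _ fin'(3) E_sub])
      (auto simp: S_def q0 W_Nil)
  ultimately show ?thesis by simp
qed

section \<open>Subgroups of finite index\<close>

lemma word_value_Nil [simp]: "word_value G \<psi> [] = \<one>\<^bsub>G\<^esub>"
  and word_value_Cons [simp]: "word_value G \<psi> (a # w) = \<psi> a \<otimes>\<^bsub>G\<^esub> word_value G \<psi> w"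
  by (simp_all add: word_value_def)

lemma word_value_carrier [simp]: "word_value (G\<lparr>carrier := H\<rparr>) \<psi> w = word_value G \<psi> w"
  by (induction w) auto

text \<open>\<open>context_free_pair\<close> takes its letters from the naturals, whereas generating
  sets consist of group elements. The finite alphabet is renamed.\<close>

lemma semigroup_presentation_nat:
  fixes \<psi> :: "'t \<Rightarrow> 'g"
  assumes "semigroup_presentation G \<Sigma> \<psi>"
  shows "\<exists>(\<Sigma>' :: nat set) \<psi>'. semigroup_presentation G \<Sigma>' \<psi>'"
proof -
  from assms have fin: "finite \<Sigma>" and in_G: "\<psi> \<in> \<Sigma> \<rightarrow> carrier G"
    and surj: "word_value G \<psi> ` lists \<Sigma> = carrier G"
    by (auto simp: semigroup_presentation_def)
  obtain f :: "'t \<Rightarrow> nat" where f: "inj_on f \<Sigma>"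
    using finite_imp_inj_to_nat_seg[OF fin] by blast
  let ?\<psi> = "\<psi> \<circ> inv_into \<Sigma> f"
  have "word_value G ?\<psi> (map f w) = word_value G \<psi> w" if "w \<in> lists \<Sigma>" for w
    using that f by (induction w) auto
  then have "word_value G ?\<psi> ` lists (f ` \<Sigma>) = carrier G"
    unfolding lists_image image_image surj[symmetric] by (intro image_cong) auto
  then have "semigroup_presentation G (f ` \<Sigma>) ?\<psi>"
    using fin in_G f by (auto simp: semigroup_presentation_def)
  then show ?thesis by blast
qed

context group
begin

lemma word_value_closed: "\<psi> \<in> \<Sigma> \<rightarrow> carrier G \<Longrightarrow> w \<in> lists \<Sigma> \<Longrightarrow> word_value G \<psi> w \<in> carrier G"
  by (induction w) auto

lemma word_value_append:
  assumes "\<psi> \<in> \<Sigma> \<rightarrow> carrier G" "u \<in> lists \<Sigma>" "v \<in> lists \<Sigma>"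
  shows "word_value G \<psi> (u @ v) = word_value G \<psi> u \<otimes> word_value G \<psi> v"
  using assms(2)
proof induction
  case Nil
  then show ?case using word_value_closed[OF assms(1,3)] by simp
next
  case (Cons a u)
  then show ?case
    using word_value_closed[OF assms(1)] assms by (simp add: m_assoc Pi_iff del: in_lists_conv_set)
qed

text \<open>Adjoining inverses to a finite generating set makes it generate the group as a
  monoid.\<close>

lemma ex_semigroup_presentation:
  assumes "finitely_generated_group G"
  shows "\<exists>(\<Sigma> :: nat set) \<psi>. semigroup_presentation G \<Sigma> \<psi>"
proof -
  obtain S where S: "finite S" "S \<subseteq> carrier G" "generate G S = carrier G"
    using assms by (auto simp: finitely_generated_group_def)
  let ?S = "S \<union> m_inv G ` S"
  have id: "id \<in> ?S \<rightarrow> carrier G" using S by auto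
  have "\<exists>w\<in>lists ?S. word_value G id w = g" if "g \<in> generate G S" for g
    using that
  proof induction
    case one
    show ?case by (intro bexI[of _ "[]"]) auto
  next
    case (incl h)
    then show ?case using S by (intro bexI[of _ "[h]"]) auto
  next
    case (inv h)
    then show ?case using S by (intro bexI[of _ "[inv h]"]) auto
  next
    case (eng h1 h2)
    then show ?case using word_value_append[OF id] by (metis append_in_lists_conv)
  qed
  then have "word_value G id ` lists ?S = carrier G"
    using S word_value_closed[OF id] by blast
  then have "semigroup_presentation G ?S id" using S id by (simp add: semigroup_presentation_def)
  then show ?thesis by (rule semigroup_presentation_nat)
qed

section \<open>Transversals and Schreier rewriting\<close>

text \<open>\<open>\<tau>\<close> sends \<open>g\<close> to the chosen representative of its right
  coset. The unit is inserted into \<open>Q\<close> as a start state, so the coset \<open>H\<close>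
  may have two representatives there.\<close>

lemma finite_index_transversal:
  assumes "subgroup H G" "finite (rcosets H)"
  obtains Q \<tau> where "finite Q" "Q \<subseteq> carrier G" "\<one> \<in> Q"
    and "\<And>g. g \<in> carrier G \<Longrightarrow> \<tau> g \<in> Q" and "\<And>g. g \<in> carrier G \<Longrightarrow> g \<otimes> inv (\<tau> g) \<in> H"
proof -
  define rep where "rep C = (SOME x. x \<in> C)" for C :: "'a set"
  have rep: "rep (H #> g) \<in> H #> g" if "g \<in> carrier G" for g
    unfolding rep_def using rcos_self[OF that assms(1)] by (rule someI)
  show thesis
  proof
    show "finite (insert \<one> (rep ` (rcosets H)))" using assms by simp
    show "insert \<one> (rep ` (rcosets H)) \<subseteq> carrier G"
      using rep r_coset_subset_G[OF subgroup.subset[OF assms(1)]] by (fastforce simp: RCOSETS_def)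
    show "rep (H #> g) \<in> insert \<one> (rep ` (rcosets H))" if "g \<in> carrier G" for g
      using that by (auto simp: RCOSETS_def)
    fix g assume g: "g \<in> carrier G"
    with rep obtain h where h: "h \<in> H" "rep (H #> g) = h \<otimes> g" by (auto simp: r_coset_def)
    have "h \<in> carrier G" using subgroup.mem_carrier[OF assms(1) h(1)] .
    with g h(2) have "g \<otimes> inv (rep (H #> g)) = inv h"
      by (simp add: inv_mult_group flip: m_assoc)
    with h(1) show "g \<otimes> inv (rep (H #> g)) \<in> H" using assms(1) by (simp add: subgroup.m_inv_closed)
  qed simp
qed

text \<open>The product of the outputs telescopes: the inverse of each intermediate state cancels
  against the state that begins the next factor.\<close>

lemma seq_output_value:
  assumes Q: "Q \<subseteq> carrier G" and \<psi>: "\<psi> \<in> \<Sigma> \<rightarrow> carrier G" and \<phi>: "\<phi> \<in> \<Delta> \<rightarrow> carrier G"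
    and \<delta>: "\<And>s a. s \<in> Q \<Longrightarrow> a \<in> \<Sigma> \<Longrightarrow> \<delta> s a \<in> Q"
    and out: "\<And>s a. s \<in> Q \<Longrightarrow> a \<in> \<Sigma> \<Longrightarrow> out s a \<in> lists \<Delta>"
    and val: "\<And>s a. s \<in> Q \<Longrightarrow> a \<in> \<Sigma> \<Longrightarrow> word_value G \<phi> (out s a) = s \<otimes> \<psi> a \<otimes> inv (\<delta> s a)"
    and "w \<in> lists \<Sigma>" "s \<in> Q"
  shows "foldl \<delta> s w \<in> Q \<and> seq_output \<delta> out s w \<in> lists \<Delta> \<and>
    word_value G \<phi> (seq_output \<delta> out s w) \<otimes> foldl \<delta> s w = s \<otimes> word_value G \<psi> w"
  using assms(7,8)
proof (induction w arbitrary: s rule: list.induct)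
  case Nil
  then show ?case using Q by auto
next
  case (Cons a w)
  let ?s = "\<delta> s a" and ?o = "seq_output \<delta> out (\<delta> s a) w"
  have a: "a \<in> \<Sigma>" "w \<in> lists \<Sigma>" using Cons.prems by auto
  have IH: "foldl \<delta> ?s w \<in> Q" "?o \<in> lists \<Delta>"
    "word_value G \<phi> ?o \<otimes> foldl \<delta> ?s w = ?s \<otimes> word_value G \<psi> w"
    using Cons.IH[OF a(2) \<delta>[OF Cons.prems(2) a(1)]] by auto
  have c: "s \<in> carrier G" "?s \<in> carrier G" "\<psi> a \<in> carrier G"
    "word_value G \<psi> w \<in> carrier G" "word_value G \<phi> ?o \<in> carrier G" "foldl \<delta> ?s w \<in> carrier G"
    using Cons.prems(2) a \<delta>[OF Cons.prems(2) a(1)] Q \<psi> IH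
      word_value_closed[OF \<psi> a(2)] word_value_closed[OF \<phi> IH(2)] by auto
  have cancel: "inv ?s \<otimes> (?s \<otimes> word_value G \<psi> w) = word_value G \<psi> w"
    using c by (simp flip: m_assoc)
  have "word_value G \<phi> (seq_output \<delta> out s (a # w)) \<otimes> foldl \<delta> s (a # w)
      = word_value G \<phi> (out s a) \<otimes> (word_value G \<phi> ?o \<otimes> foldl \<delta> ?s w)"
    using word_value_append[OF \<phi> out[OF Cons.prems(2) a(1)] IH(2)] c
      val[OF Cons.prems(2) a(1)] by (simp add: m_assoc)
  also have "\<dots> = s \<otimes> word_value G \<psi> (a # w)"
    unfolding IH(3) val[OF Cons.prems(2) a(1)] using c cancel by (simp add: m_assoc)
  finally show ?case using IH out Cons.prems by simp
qed

text \<open>Schreier's argument: the outputs of the coset automaton, together with the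
  representatives that lie in \<open>H\<close>, form a finite alphabet for \<open>H\<close>. Group
  elements serve as letters here, so the valuation is \<open>id\<close>.\<close>

lemma ex_semigroup_presentation_subgroup:
  assumes "semigroup_presentation G \<Sigma> \<psi>" and H: "subgroup H G" and "finite (rcosets H)"
  shows "\<exists>(\<Sigma>' :: nat set) \<psi>'. semigroup_presentation (G\<lparr>carrier := H\<rparr>) \<Sigma>' \<psi>'"
proof -
  from assms have fin: "finite \<Sigma>" and \<psi>: "\<psi> \<in> \<Sigma> \<rightarrow> carrier G"
    and surj: "word_value G \<psi> ` lists \<Sigma> = carrier G"
    by (auto simp: semigroup_presentation_def)
  obtain Q \<tau> where Q: "finite Q" "Q \<subseteq> carrier G" "\<one> \<in> Q"
    and \<tau>: "\<And>g. g \<in> carrier G \<Longrightarrow> \<tau> g \<in> Q" "\<And>g. g \<in> carrier G \<Longrightarrow> g \<otimes> inv (\<tau> g) \<in> H"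
    using finite_index_transversal[OF H assms(3)] by blast
  define \<delta> where "\<delta> s a = \<tau> (s \<otimes> \<psi> a)" for s a
  define y where "y s a = s \<otimes> \<psi> a \<otimes> inv (\<delta> s a)" for s a
  \<comment> \<open>After a word with value in \<open>H\<close>, the automaton is in a state of
    \<open>H\<close> that need not be the unit. \<open>Q \<inter> H\<close> supplies the letter that
    makes up for it.\<close>
  define Y where "Y = case_prod y ` (Q \<times> \<Sigma>) \<union> (Q \<inter> H)"
  have \<delta>: "\<delta> s a \<in> Q" if "s \<in> Q" "a \<in> \<Sigma>" for s a using that Q \<psi> \<tau> by (auto simp: \<delta>_def Pi_iff subset_eq)
  have "Y \<subseteq> H" using Q \<psi> \<tau> by (auto simp: Y_def y_def \<delta>_def Pi_iff subset_eq)
  have HG: "H \<subseteq> carrier G" using H by (rule subgroup.subset)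
  have id: "id \<in> Y \<rightarrow> carrier G" using \<open>Y \<subseteq> H\<close> HG by auto
  have prod_H: "word_value G id w \<in> H" if "w \<in> lists Y" for w
    using that by induction (use \<open>Y \<subseteq> H\<close> H in \<open>auto simp: subgroup.one_closed subgroup.m_closed\<close>)
  have "\<exists>u\<in>lists Y. word_value G id u = h" if "h \<in> H" for h
  proof -
    have "h \<in> word_value G \<psi> ` lists \<Sigma>" using that HG surj by auto
    then obtain w where w: "w \<in> lists \<Sigma>" "word_value G \<psi> w = h" by auto
    define u where "u = seq_output \<delta> (\<lambda>s a. [y s a]) \<one> w"
    define s where "s = foldl \<delta> \<one> w"
    have yY: "[y s a] \<in> lists Y" and yv: "word_value G id [y s a] = s \<otimes> \<psi> a \<otimes> inv (\<delta> s a)"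
      if "s \<in> Q" "a \<in> \<Sigma>" for s a
    proof -
      show "[y s a] \<in> lists Y" using that by (auto simp: Y_def)
      then show "word_value G id [y s a] = s \<otimes> \<psi> a \<otimes> inv (\<delta> s a)"
        using id HG \<open>Y \<subseteq> H\<close> by (auto simp: y_def subset_eq)
    qed
    have u: "s \<in> Q" "u \<in> lists Y" "word_value G id u \<otimes> s = h"
      using seq_output_value[OF Q(2) \<psi> id \<delta> yY yv w(1) Q(3)] w HG that
      by (auto simp: u_def s_def)
    have "s \<in> carrier G" "word_value G id u \<in> carrier G" using u Q prod_H HG by auto
    then have "s = inv (word_value G id u) \<otimes> h"
      unfolding u(3)[symmetric] by (simp flip: m_assoc)
    then have "s \<in> H" using that u prod_H H by (simp add: subgroup.m_closed subgroup.m_inv_closed)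
    then have "u @ [s] \<in> lists Y" "word_value G id (u @ [s]) = h"
      using u \<open>s \<in> carrier G\<close> word_value_append[OF id, of u "[s]"] by (auto simp: Y_def)
    then show ?thesis by blast
  qed
  then have "word_value G id ` lists Y = H" using prod_H by blast
  moreover have "finite Y" using Q fin by (simp add: Y_def)
  ultimately have "semigroup_presentation (G\<lparr>carrier := H\<rparr>) Y id"
    using \<open>Y \<subseteq> H\<close> by (auto simp: semigroup_presentation_def)
  then show ?thesis by (rule semigroup_presentation_nat)
qed

section \<open>From the group to the subgroup\<close>

text \<open>Replacing each letter for \<open>H\<close> by a word over \<open>\<Sigma>\<close> of the
  same value is a monoid homomorphism that preserves values, and the language for \<open>H\<close>
  is the preimage under it.\<close>

lemma context_free_pair_finite_index_subgroup:
  assumes "context_free_pair G K" and H: "subgroup H G" and index: "finite (rcosets H)"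
  shows "context_free_pair (G\<lparr>carrier := H\<rparr>) (K \<inter> H)"
proof -
  obtain \<Sigma> :: "nat set" and \<psi> where pres: "semigroup_presentation G \<Sigma> \<psi>"
    and cf: "context_free_language \<Sigma> (subgroup_language G K \<Sigma> \<psi>)"
    using assms(1) by (auto simp: context_free_pair_def)
  obtain \<Sigma>' :: "nat set" and \<phi> where pres': "semigroup_presentation (G\<lparr>carrier := H\<rparr>) \<Sigma>' \<phi>"
    using ex_semigroup_presentation_subgroup[OF pres H index] by blast
  have \<psi>: "\<psi> \<in> \<Sigma> \<rightarrow> carrier G" and surj: "word_value G \<psi> ` lists \<Sigma> = carrier G" and fin: "finite \<Sigma>"
    using pres by (auto simp: semigroup_presentation_def)
  have \<phi>: "\<phi> \<in> \<Sigma>' \<rightarrow> H" and surj': "word_value G \<phi> ` lists \<Sigma>' = H" and fin': "finite \<Sigma>'"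
    using pres' by (auto simp: semigroup_presentation_def)
  have "\<exists>u\<in>lists \<Sigma>. word_value G \<psi> u = \<phi> a" if "a \<in> \<Sigma>'" for a
  proof -
    have "\<phi> a \<in> word_value G \<psi> ` lists \<Sigma>" using that \<phi> surj subgroup.subset[OF H] by auto
    then show ?thesis by auto
  qed
  then obtain u where u: "\<And>a. a \<in> \<Sigma>' \<Longrightarrow> u a \<in> lists \<Sigma>" "\<And>a. a \<in> \<Sigma>' \<Longrightarrow> word_value G \<psi> (u a) = \<phi> a"
    by metis
  let ?\<delta> = "\<lambda>_ _. ()" and ?out = "\<lambda>_. u"
  have val: "seq_output ?\<delta> ?out q w \<in> lists \<Sigma> \<and> word_value G \<psi> (seq_output ?\<delta> ?out q w) = word_value G \<phi> w"
    if "w \<in> lists \<Sigma>'" for q w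
    using that
  proof (induction w arbitrary: q)
    case (Cons a w)
    then show ?case using word_value_append[OF \<psi> u(1)] u by auto
  qed simp
  have "context_free_language \<Sigma>' {w \<in> lists \<Sigma>'. \<exists>z. (foldl ?\<delta> () w, z) \<in> {((), [])} \<and>
      seq_output ?\<delta> ?out () w @ z \<in> subgroup_language G K \<Sigma> \<psi>}"
    by (rule context_free_sequential_preimage[OF cf fin fin', where Q = UNIV]) (auto simp: u)
  also have "{w \<in> lists \<Sigma>'. \<exists>z. (foldl ?\<delta> () w, z) \<in> {((), [])} \<and>
      seq_output ?\<delta> ?out () w @ z \<in> subgroup_language G K \<Sigma> \<psi>}
    = subgroup_language (G\<lparr>carrier := H\<rparr>) (K \<inter> H) \<Sigma>' \<phi>"
  proof -
    have "(\<exists>z. (foldl ?\<delta> () w, z) \<in> {((), [])} \<and> seq_output ?\<delta> ?out () w @ z \<in> subgroup_language G K \<Sigma> \<psi>)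
        \<longleftrightarrow> word_value G \<phi> w \<in> K \<inter> H" if w: "w \<in> lists \<Sigma>'" for w
    proof -
      \<comment> \<open>Words over \<open>\<Sigma>'\<close> have values in \<open>H\<close> anyway,
        so testing for \<open>K\<close> already tests for \<open>K \<inter> H\<close>.\<close>
      have "word_value G \<phi> w \<in> H" using surj' w by blast
      then show ?thesis using val[OF w, of "()"] by (auto simp: subgroup_language_def)
    qed
    then show ?thesis unfolding subgroup_language_def[of "G\<lparr>carrier := H\<rparr>"] word_value_carrier by blast
  qed
  finally show ?thesis using pres' by (auto simp: context_free_pair_def)
qed

section \<open>From the subgroup to the group\<close>

lemma context_free_pair_finite_index_overgroup:
  assumes "context_free_pair (G\<lparr>carrier := H\<rparr>) (K \<inter> H)" and fg: "finitely_generated_group G"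
    and K: "subgroup K G" and H: "subgroup H G" and index: "finite (rcosets H)"
  shows "context_free_pair G K"
proof -
  obtain \<Delta> :: "nat set" and \<phi> where pres': "semigroup_presentation (G\<lparr>carrier := H\<rparr>) \<Delta> \<phi>"
    and cf: "context_free_language \<Delta> (subgroup_language (G\<lparr>carrier := H\<rparr>) (K \<inter> H) \<Delta> \<phi>)"
    using assms(1) by (auto simp: context_free_pair_def)
  obtain \<Sigma> :: "nat set" and \<psi> where pres: "semigroup_presentation G \<Sigma> \<psi>"
    using ex_semigroup_presentation[OF fg] by blast
  have \<psi>: "\<psi> \<in> \<Sigma> \<rightarrow> carrier G" and surj: "word_value G \<psi> ` lists \<Sigma> = carrier G" and fin: "finite \<Sigma>"
    using pres by (auto simp: semigroup_presentation_def)
  have surj': "word_value G \<phi> ` lists \<Delta> = H" and fin': "finite \<Delta>"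
    and \<phi>: "\<phi> \<in> \<Delta> \<rightarrow> carrier G"
    using pres' subgroup.subset[OF H] by (auto simp: semigroup_presentation_def Pi_iff)
  obtain Q \<tau> where Q: "finite Q" "Q \<subseteq> carrier G" "\<one> \<in> Q"
    and \<tau>: "\<And>g. g \<in> carrier G \<Longrightarrow> \<tau> g \<in> Q" "\<And>g. g \<in> carrier G \<Longrightarrow> g \<otimes> inv (\<tau> g) \<in> H"
    using finite_index_transversal[OF H index] by blast
  have "\<forall>h\<in>H. \<exists>u. u \<in> lists \<Delta> \<and> word_value G \<phi> u = h" using surj' by blast
  then obtain word where word: "\<And>h. h \<in> H \<Longrightarrow> word h \<in> lists \<Delta>" "\<And>h. h \<in> H \<Longrightarrow> word_value G \<phi> (word h) = h"
    by metis
  define \<delta> where "\<delta> s a = \<tau> (s \<otimes> \<psi> a)" for s a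
  define out where "out s a = word (s \<otimes> \<psi> a \<otimes> inv (\<delta> s a))" for s a
  \<comment> \<open>The condition says that \<open>k\<close> lies in the coset of \<open>s\<close>.
    So \<open>P\<close> consists of the states whose coset meets \<open>K\<close>, and
    \<open>k s\<close> is a fixed element of the intersection.\<close>
  define k where "k s = (SOME k. k \<in> K \<and> s \<otimes> inv k \<in> H)" for s
  define P where "P = {s \<in> Q. \<exists>k. k \<in> K \<and> s \<otimes> inv k \<in> H}"
  \<comment> \<open>States outside \<open>P\<close> get no final output, so words ending there are
    rejected.\<close>
  define F where "F = (\<lambda>s. (s, word (s \<otimes> inv (k s)))) ` P"
  have k: "k s \<in> K" "s \<otimes> inv (k s) \<in> H" if "s \<in> P" for s
    using that someI_ex[of "\<lambda>k. k \<in> K \<and> s \<otimes> inv k \<in> H"] by (auto simp: P_def k_def)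
  have \<delta>: "\<delta> s a \<in> Q" and y: "s \<otimes> \<psi> a \<otimes> inv (\<delta> s a) \<in> H" if "s \<in> Q" "a \<in> \<Sigma>" for s a
    using that Q \<psi> \<tau> by (auto simp: \<delta>_def Pi_iff subset_eq)
  have out: "out s a \<in> lists \<Delta>" "word_value G \<phi> (out s a) = s \<otimes> \<psi> a \<otimes> inv (\<delta> s a)"
    if "s \<in> Q" "a \<in> \<Sigma>" for s a
    using word[OF y[OF that]] by (auto simp: out_def)
  have iff: "(\<exists>z. (foldl \<delta> \<one> w, z) \<in> F \<and>
      seq_output \<delta> out \<one> w @ z \<in> subgroup_language (G\<lparr>carrier := H\<rparr>) (K \<inter> H) \<Delta> \<phi>)
    \<longleftrightarrow> word_value G \<psi> w \<in> K" if w: "w \<in> lists \<Sigma>" for w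
  proof -
    define s where "s = foldl \<delta> \<one> w"
    define u where "u = seq_output \<delta> out \<one> w"
    define g where "g = word_value G \<psi> w"
    define h where "h = word_value G \<phi> u"
    have g: "g \<in> carrier G" using w \<psi> word_value_closed by (simp add: g_def)
    have s: "s \<in> Q" "u \<in> lists \<Delta>" "h \<otimes> s = g"
      using seq_output_value[OF Q(2) \<psi> \<phi> \<delta> out w Q(3)] g by (auto simp: s_def u_def g_def h_def)
    have h: "h \<in> H" using s surj' by (auto simp: h_def)
    have c: "s \<in> carrier G" "h \<in> carrier G" using s Q h subgroup.mem_carrier[OF H] by auto
    show ?thesis
    proof (cases "s \<in> P")
      case True
      let ?z = "word (s \<otimes> inv (k s))"
      have kc: "k s \<in> carrier G" using k(1)[OF True] subgroup.mem_carrier[OF K] by blast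
      have "word_value G \<phi> (u @ ?z) = h \<otimes> (s \<otimes> inv (k s))"
        using word_value_append[OF \<phi> s(2) word(1)] word(2) k[OF True] by (simp add: h_def)
      also have "\<dots> = g \<otimes> inv (k s)" using c kc s by (simp add: m_assoc[symmetric])
      finally have val: "word_value G \<phi> (u @ ?z) = g \<otimes> inv (k s)" .
      have z: "u @ ?z \<in> lists \<Delta>" using s word k[OF True] by simp
      have "g \<otimes> inv (k s) \<in> H" using val z surj' by (metis imageI)
      moreover have "g \<otimes> inv (k s) \<in> K \<longleftrightarrow> g \<in> K"
      proof
        assume "g \<otimes> inv (k s) \<in> K"
        then have "g \<otimes> inv (k s) \<otimes> k s \<in> K" using k(1)[OF True] K by (simp add: subgroup.m_closed)
        then show "g \<in> K" using g kc by (simp add: m_assoc)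
      next
        assume "g \<in> K"
        then show "g \<otimes> inv (k s) \<in> K"
          using k(1)[OF True] K by (simp add: subgroup.m_closed subgroup.m_inv_closed)
      qed
      moreover have "(s, z) \<in> F \<longleftrightarrow> z = ?z" for z using True by (auto simp: F_def)
      ultimately show ?thesis using z val
        unfolding subgroup_language_def word_value_carrier s_def[symmetric] u_def[symmetric] g_def[symmetric]
        by (metis (lifting) CollectD CollectI Int_iff)
    next
      case False
      have "g \<notin> K"
      proof
        assume "g \<in> K"
        \<comment> \<open>An element \<open>g\<close> of \<open>K\<close> reached at
          \<open>s\<close> would itself witness that the coset of \<open>s\<close> meets
          \<open>K\<close>.\<close>
        moreover have "s \<otimes> inv g = inv h" unfolding s(3)[symmetric] using c by (simp add: inv_mult_group flip: m_assoc)
        ultimately show False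
          using False s h H by (auto simp: P_def subgroup.m_inv_closed)
      qed
      moreover have "(s, z) \<notin> F" for z using False by (auto simp: F_def)
      ultimately show ?thesis unfolding s_def[symmetric] g_def[symmetric] by blast
    qed
  qed
  have "context_free_language \<Sigma> {w \<in> lists \<Sigma>. \<exists>z. (foldl \<delta> \<one> w, z) \<in> F \<and>
      seq_output \<delta> out \<one> w @ z \<in> subgroup_language (G\<lparr>carrier := H\<rparr>) (K \<inter> H) \<Delta> \<phi>}"
  proof (rule context_free_sequential_preimage[OF cf fin' fin Q(1) _ Q(3) \<delta> out(1)])
    show "finite F" using Q by (simp add: F_def P_def)
    show "F \<subseteq> Q \<times> lists \<Delta>" using k word by (auto simp: F_def P_def)
  qed
  also have "{w \<in> lists \<Sigma>. \<exists>z. (foldl \<delta> \<one> w, z) \<in> F \<and>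
      seq_output \<delta> out \<one> w @ z \<in> subgroup_language (G\<lparr>carrier := H\<rparr>) (K \<inter> H) \<Delta> \<phi>}
    = subgroup_language G K \<Sigma> \<psi>"
    using iff by (auto simp: subgroup_language_def)
  finally show ?thesis using pres by (auto simp: context_free_pair_def)
qed

end

theorem mainTheorem9:
  fixes G :: "('g, 'm) monoid_scheme" and K H :: "'g set"
  assumes "finitely_generated_group G"
    and "subgroup K G"
    and "subgroup H G"
    and "finite (rcosets\<^bsub>G\<^esub> H)"
  shows "context_free_pair G K \<longleftrightarrow> context_free_pair (G\<lparr>carrier := H\<rparr>) (K \<inter> H)"
proof -
  have "group G" using assms(1) unfolding finitely_generated_group_def by (rule conjunct1)
  then show ?thesis
    using group.context_free_pair_finite_index_subgroup[OF _ _ assms(3,4)]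
      group.context_free_pair_finite_index_overgroup[OF _ _ assms] by (intro iffI)
qed

end
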